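(* Let $n \in \mathbb{N}$ and let $\mathcal{F} \subseteq \mathcal{P}([n])$ be a nontrivial, union closed family such that $$\#\{F \in \mathcal{F}: 1 \in F\} \geq \#\{F \in \mathcal{F}: 2 \in F\} \geq \dots \geq \#\{F \in \mathcal{F}: n \in F\}.$$ Then for $k = n$, and (when $n \geq 2$) also for $k = n-1$, it holds $$\#\{F \in \mathcal{F}: k \in F\} \geq \frac{1}{2^{k-1}+1} \cdot \#\mathcal{F}.$$
   Context: $[n] = \{1,\dots,n\}$ and $\mathcal{P}([n])$ is its power set; $\#X$ denotes cardinality. A family $\mathcal{F} \subseteq \mathcal{P}([n])$ is nontrivial if $\bigcup_{F \in \mathcal{F}} F = [n]$, and union closed if $A, B \in \mathcal{F}$ implies $A \cup B \in \mathcal{F}$. *)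

theory Defs
  imports Complex_Main
begin

definition nontrivial_family :: "nat \<Rightarrow> nat set set \<Rightarrow> bool" where
  "nontrivial_family n \<F> \<longleftrightarrow> \<Union>\<F> = {1..n}"

definition union_closed :: "'a set set \<Rightarrow> bool" where
  "union_closed \<F> \<longleftrightarrow> (\<forall>A\<in>\<F>. \<forall>B\<in>\<F>. A \<union> B \<in> \<F>)"

end

theory Submission
  imports Defs
begin

text \<open>
  Write \<open>d k\<close> for the number of members containing \<open>k\<close>. It suffices to bound the number of
  members avoiding \<open>k\<close> by \<open>2 ^ (k - 1) * d k\<close>. For \<open>k = n\<close> this is clear, since \<open>d n \<ge> 1\<close>.
  For \<open>k = n - 1\<close> there are at most \<open>2 ^ (n - 1)\<close> such members, which is enough if \<open>d k \<ge> 2\<close>.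
  If \<open>d k = 1\<close>, then \<open>d n \<le> 1\<close>; joining a member that contains \<open>n\<close> with the one that contains \<open>k\<close>
  shows that they coincide, so members avoiding \<open>k\<close> also avoid \<open>n\<close> and there are at most
  \<open>2 ^ (n - 2)\<close> of them.
\<close>

lemma frequency_bound_if_avoiding_bound:
  assumes "finite \<F>"
    and "card {F \<in> \<F>. k \<notin> F} \<le> m * card {F \<in> \<F>. k \<in> F}"
  shows "1 / (real m + 1) * real (card \<F>) \<le> real (card {F \<in> \<F>. k \<in> F})"
proof -
  have "card \<F> = card ({F \<in> \<F>. k \<in> F} \<union> {F \<in> \<F>. k \<notin> F})"
    by (rule arg_cong[of _ _ card]) blast
  also have "\<dots> = card {F \<in> \<F>. k \<in> F} + card {F \<in> \<F>. k \<notin> F}"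
    using assms(1) by (intro card_Un_disjoint) auto
  also have "\<dots> \<le> (m + 1) * card {F \<in> \<F>. k \<in> F}"
    using assms(2) by simp
  finally have "real (card \<F>) \<le> real ((m + 1) * card {F \<in> \<F>. k \<in> F})"
    by (simp only: of_nat_le_iff)
  then show ?thesis
    by (simp add: divide_simps algebra_simps)
qed

text \<open>If \<open>A\<close> is the unique member containing \<open>a\<close>, then
  \<open>A \<union> C\<close> is a member containing \<open>b\<close>. At most one member contains
  \<open>b\<close>, so this union is \<open>C\<close> itself.\<close>

lemma union_closed_mem_if_unique:
  assumes "union_closed \<F>" and "finite \<F>"
    and "card {F \<in> \<F>. a \<in> F} = 1" and "card {F \<in> \<F>. b \<in> F} \<le> 1"
    and "C \<in> \<F>" and "b \<in> C"
  shows "a \<in> C"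
proof -
  obtain A where A: "{F \<in> \<F>. a \<in> F} = {A}"
    using assms(3) by (auto simp: card_1_singleton_iff)
  then have AC: "A \<union> C \<in> \<F>"
    using assms(1,5) unfolding union_closed_def by blast
  have "A \<union> C = C"
    using assms(2,4-6) AC by (auto simp: card_le_Suc0_iff_eq)
  then show ?thesis
    using A by blast
qed

theorem theorem2p6:
  fixes n :: nat and \<F> :: "nat set set"
  assumes "n \<ge> 1"
    and "\<F> \<subseteq> Pow {1..n}"
    and "nontrivial_family n \<F>"
    and "union_closed \<F>"
    and "\<forall>i\<in>{1..<n}. card {F \<in> \<F>. i \<in> F} \<ge> card {F \<in> \<F>. i + 1 \<in> F}"
  shows "\<forall>k. k = n \<or> (n \<ge> 2 \<and> k = n - 1) \<longrightarrow>
           real (card {F \<in> \<F>. k \<in> F}) \<ge> 1 / (2 ^ (k - 1) + 1) * real (card \<F>)"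
proof (intro allI impI)
  fix k assume k: "k = n \<or> (n \<ge> 2 \<and> k = n - 1)"
  let ?d = "\<lambda>i. card {F \<in> \<F>. i \<in> F}"
  have fin: "finite \<F>"
    using assms(2) finite_subset by blast
  have k_mem: "k \<in> {1..n}"
    using k assms(1) by auto
  then have "{F \<in> \<F>. k \<in> F} \<noteq> {}"
    using assms(3) unfolding nontrivial_family_def by blast
  then have d_pos: "?d k \<ge> 1"
    using fin by (simp add: Suc_le_eq card_gt_0_iff)
  \<comment> \<open>Applied twice: \<open>S\<close> omits only \<open>k\<close> in the general
    bound, and both \<open>k\<close> and \<open>n\<close> when \<open>?d k = 1\<close>.\<close>
  have card_avoid: "card {F \<in> \<F>. k \<notin> F} \<le> 2 ^ card S"
    if "{F \<in> \<F>. k \<notin> F} \<subseteq> Pow S" "finite S" for S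
    using card_mono[OF _ that(1)] that(2) by (simp add: card_Pow)
  have "card {F \<in> \<F>. k \<notin> F} \<le> 2 ^ card ({1..n} - {k})"
    using assms(2) by (intro card_avoid) auto
  then have avoid: "card {F \<in> \<F>. k \<notin> F} \<le> 2 ^ (n - 1)"
    using k_mem by simp
  have "card {F \<in> \<F>. k \<notin> F} \<le> 2 ^ (k - 1) * ?d k"
  proof -
    consider "k = n" | "k = n - 1" "n \<ge> 2" "?d k \<ge> 2" | "k = n - 1" "n \<ge> 2" "?d k = 1"
      using k d_pos by linarith
    then show ?thesis
    proof cases
      case 1
      then have "2 ^ (n - 1) * 1 \<le> 2 ^ (k - 1) * ?d k"
        using d_pos by (intro mult_mono) auto
      then show ?thesis
        using avoid by linarith
    next
      case 2
      \<comment> \<open>Since \<open>k \<ge> 1\<close>, the subtraction \<open>k - 1\<close> is not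
        truncated; the extra factor 2 is absorbed by \<open>?d k \<ge> 2\<close>.\<close>
      then have "2 ^ (n - 1) = 2 ^ (k - 1) * (2::nat)"
        by (cases n; cases "n - 1") auto
      also have "\<dots> \<le> 2 ^ (k - 1) * ?d k"
        using 2 by (intro mult_mono) auto
      finally show ?thesis
        using avoid by linarith
    next
      case 3
      then have "k \<in> {1..<n}" "k + 1 = n"
        by auto
      then have "?d n \<le> 1"
        using assms(5) 3 by metis
      then have "k \<in> C" if "C \<in> \<F>" "n \<in> C" for C
        using union_closed_mem_if_unique[OF assms(4) fin 3(3) _ that] by blast
      then have "{F \<in> \<F>. k \<notin> F} \<subseteq> Pow ({1..n} - {k, n})"
        using assms(2) by blast
      then have "card {F \<in> \<F>. k \<notin> F} \<le> 2 ^ card ({1..n} - {k, n})"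
        by (intro card_avoid) auto
      \<comment> \<open>Here \<open>k\<close> and \<open>n\<close> are distinct, so
        \<open>n - 2 = k - 1\<close> elements remain.\<close>
      also have "card ({1..n} - {k, n}) = k - 1"
        using 3 by (subst card_Diff_subset) auto
      finally show ?thesis
        using 3 by simp
    qed
  qed
  from frequency_bound_if_avoiding_bound[OF fin this]
  show "real (?d k) \<ge> 1 / (2 ^ (k - 1) + 1) * real (card \<F>)"
    by simp
qed

end
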